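(* Let $\pi:N\to N$ be a permutation and $m\in\mathbb{R}^{\mathcal{P}(N)}$. Then: (i) $m\in\mathcal{K}(N)$ if and only if $T_\pi(m)\in\mathcal{K}(N)$, and the independency model induced by $T_\pi(m)$ is determined as follows: for any $\langle a,b|C\rangle\in\mathcal{E}(N)$, $$a\perp b\mid C\ [T_\pi(m)]\iff \pi(a)\perp\pi(b)\mid \boldsymbol{\pi}(C)\ [m].$$ In particular, $T_\pi$ maps $\mathcal{K}(N)$ onto $\mathcal{K}(N)$. (ii) $T_\pi$ maps faces of $\mathcal{K}(N)$ to faces of $\mathcal{K}(N)$ and preserves inclusion: $G\subseteq F$ if and only if $T_\pi(G)\subseteq T_\pi(F)$ for any $G,F\subseteq\mathbb{R}^{\mathcal{P}(N)}$. In particular, $m\in\mathcal{K}(N)$ is extreme in $\mathcal{K}(N)$ if and only if $T_\pi(m)$ is extreme in $\mathcal{K}(N)$.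
   Context: $N$ is a finite set with $|N|\ge 2$ and $\mathcal{P}(N)$ is its power set; a singleton $\{a\}$ is written $a$. $\mathbb{R}^{\mathcal{P}(N)}$ is the space of functions $m:\mathcal{P}(N)\to\mathbb{R}$ with scalar product $\langle m,u\rangle=\sum_{A\subseteq N}m(A)u(A)$. A function $m$ is supermodular if $m(A)+m(B)\le m(A\cup B)+m(A\cap B)$ for all $A,B\subseteq N$; $\mathcal{K}(N)$ is the cone of supermodular functions. $\mathcal{E}(N)$ is the set of triplets $\langle a,b|C\rangle$ with $a,b\in N$ distinct and $C\subseteq N\setminus\{a,b\}$. For $m\in\mathbb{R}^{\mathcal{P}(N)}$, $a\perp b\mid C\ [m]$ means $m(a\cup b\cup C)+m(C)-m(a\cup C)-m(b\cup C)=0$. The independency model induced by $m\in\mathcal{K}(N)$ is the set of $\langle a,b|C\rangle\in\mathcal{E}(N)$ with $a\perp b\mid C\ [m]$. A face of a convex cone $K\subseteq\mathbb{R}^{\mathcal{P}(N)}$ is a set $\{m\in K: k=\langle m,v\rangle\}$, where $v\in\mathbb{R}^{\mathcal{P}(N)}$, $k\in\mathbb{R}$ satisfy $k\le\langle m,v\rangle$ for all $m\in K$. The non-empty faces of $\mathcal{K}(N)$ form a lattice under inclusion with least element the space of modular functions $\mathcal{K}(N)\cap(-\mathcal{K}(N))$. A function $m\in\mathcal{K}(N)$ is extreme in $\mathcal{K}(N)$ if the smallest face of $\mathcal{K}(N)$ containing $m$ is an atom of this lattice. For a permutation (bijection) $\pi:N\to N$ put $\boldsymbol{\pi}(S)=\{\pi(i):i\in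 S\}$ for $S\subseteq N$; the permutational transformation $T_\pi:\mathbb{R}^{\mathcal{P}(N)}\to\mathbb{R}^{\mathcal{P}(N)}$ is $[T_\pi(m)](S)=m(\boldsymbol{\pi}(S))$ for $S\subseteq N$. *)

theory Defs
  imports Complex_Main "HOL-Library.FuncSet"
begin

text \<open>
  The space of functions from the power set of \<open>N\<close> to the reals. The carrier \<open>N\<close> is explicit,
  so elements are extensional functions, making equality in this space agree with
  equality of functions on \<open>Pow N\<close>.
\<close>

definition set_functions :: "'a set \<Rightarrow> ('a set \<Rightarrow> real) set" where
  "set_functions N = (Pow N \<rightarrow>\<^sub>E UNIV)"

definition scalar_prod :: "'a set \<Rightarrow> ('a set \<Rightarrow> real) \<Rightarrow> ('a set \<Rightarrow> real) \<Rightarrow> real" where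
  "scalar_prod N m u = (\<Sum>A\<in>Pow N. m A * u A)"

definition supermodular :: "'a set \<Rightarrow> ('a set \<Rightarrow> real) \<Rightarrow> bool" where
  "supermodular N m \<longleftrightarrow> (\<forall>A B. A \<subseteq> N \<longrightarrow> B \<subseteq> N \<longrightarrow> m A + m B \<le> m (A \<union> B) + m (A \<inter> B))"

definition supermodular_cone :: "'a set \<Rightarrow> ('a set \<Rightarrow> real) set" where
  "supermodular_cone N = {m \<in> set_functions N. supermodular N m}"

definition triplets :: "'a set \<Rightarrow> ('a \<times> 'a \<times> 'a set) set" where
  "triplets N = {(a, b, C). a \<in> N \<and> b \<in> N \<and> a \<noteq> b \<and> C \<subseteq> N - {a, b}}"

definition indep :: "('a set \<Rightarrow> real) \<Rightarrow> 'a \<Rightarrow> 'a \<Rightarrow> 'a set \<Rightarrow> bool" where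
  "indep m a b C \<longleftrightarrow> m ({a} \<union> {b} \<union> C) + m C - m ({a} \<union> C) - m ({b} \<union> C) = 0"

definition indep_model :: "'a set \<Rightarrow> ('a set \<Rightarrow> real) \<Rightarrow> ('a \<times> 'a \<times> 'a set) set" where
  "indep_model N m = {(a, b, C) \<in> triplets N. indep m a b C}"

text \<open>Faces are the exposed ones; the empty set and the whole cone are allowed.\<close>

definition is_face :: "'a set \<Rightarrow> ('a set \<Rightarrow> real) set \<Rightarrow> ('a set \<Rightarrow> real) set \<Rightarrow> bool" where
  "is_face N K F \<longleftrightarrow>
     (\<exists>v\<in>set_functions N. \<exists>k::real.
        (\<forall>m\<in>K. k \<le> scalar_prod N m v) \<and> F = {m \<in> K. k = scalar_prod N m v})"

definition nonempty_faces :: "'a set \<Rightarrow> ('a set \<Rightarrow> real) set \<Rightarrow> ('a set \<Rightarrow> real) set set" where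
  "nonempty_faces N K = {F. is_face N K F \<and> F \<noteq> {}}"

definition is_least_in :: "'b set set \<Rightarrow> 'b set \<Rightarrow> bool" where
  "is_least_in L F \<longleftrightarrow> F \<in> L \<and> (\<forall>G\<in>L. F \<subseteq> G)"

text \<open>Atoms of a family of sets ordered by inclusion that has a least element.\<close>

definition is_atom_in :: "'b set set \<Rightarrow> 'b set \<Rightarrow> bool" where
  "is_atom_in L F \<longleftrightarrow>
     F \<in> L \<and> \<not> is_least_in L F \<and> (\<forall>G\<in>L. G \<subset> F \<longrightarrow> is_least_in L G)"

definition extreme_in_cone :: "'a set \<Rightarrow> ('a set \<Rightarrow> real) \<Rightarrow> bool" where
  "extreme_in_cone N m \<longleftrightarrow> m \<in> supermodular_cone N \<and>
     (\<exists>F. is_least_in {G. is_face N (supermodular_cone N) G \<and> m \<in> G} F \<and>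
          is_atom_in (nonempty_faces N (supermodular_cone N)) F)"

definition perm_transform :: "'a set \<Rightarrow> ('a \<Rightarrow> 'a) \<Rightarrow> ('a set \<Rightarrow> real) \<Rightarrow> 'a set \<Rightarrow> real" where
  "perm_transform N \<pi> m = (\<lambda>S\<in>Pow N. m (\<pi> ` S))"


text \<open>
  The least non-empty face, relative to which atoms are taken, is the space of
  modular functions.
\<close>

definition modular_functions :: "'a set \<Rightarrow> ('a set \<Rightarrow> real) set" where
  "modular_functions N =
     {m \<in> supermodular_cone N. (\<lambda>S\<in>Pow N. - m S) \<in> supermodular_cone N}"

lemma modular_functions_eq:
  "modular_functions N =
     {m \<in> set_functions N. \<forall>A B. A \<subseteq> N \<longrightarrow> B \<subseteq> N \<longrightarrow> m A + m B = m (A \<union> B) + m (A \<inter> B)}"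
proof -
  have *: "A \<inter> B \<subseteq> N" if "A \<subseteq> N" for A B :: "'a set" using that by blast
  have "supermodular N (\<lambda>S\<in>Pow N. - m S) \<longleftrightarrow>
     (\<forall>A B. A \<subseteq> N \<longrightarrow> B \<subseteq> N \<longrightarrow> m A + m B \<ge> m (A \<union> B) + m (A \<inter> B))" for m
    unfolding supermodular_def by (auto simp: * algebra_simps)
  then show ?thesis
    unfolding modular_functions_def supermodular_cone_def
    by (auto simp: supermodular_def set_functions_def intro: order_antisym)
qed

lemma modular_functions_face:
  assumes "finite N"
  shows "is_face N (supermodular_cone N) (modular_functions N)"
proof -
  define d where "d A B S = (of_bool (S = A \<union> B) + of_bool (S = A \<inter> B)
      - of_bool (S = A) - of_bool (S = B) :: real)" for A B S :: "'a set"
  define v where "v = (\<lambda>S\<in>Pow N. \<Sum>(A, B)\<in>Pow N \<times> Pow N. d A B S)"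
  have fin: "finite (Pow N)" using assms by simp
  have pick: "(\<Sum>S\<in>Pow N. m S * of_bool (S = A)) = m A" if "A \<subseteq> N" for m :: "'a set \<Rightarrow> real" and A
    using that fin by (simp add: of_bool_def if_distrib cong: if_cong)
  have dm: "(\<Sum>S\<in>Pow N. m S * d A B S) = m (A \<union> B) + m (A \<inter> B) - m A - m B"
    if "A \<subseteq> N" "B \<subseteq> N" for m :: "'a set \<Rightarrow> real" and A B
  proof -
    have "A \<inter> B \<subseteq> N" "A \<union> B \<subseteq> N" using that by auto
    then show ?thesis using that
      by (simp add: d_def distrib_left right_diff_distrib sum.distrib sum_subtractf pick)
  qed
  have sp: "scalar_prod N m v =
      (\<Sum>(A, B)\<in>Pow N \<times> Pow N. m (A \<union> B) + m (A \<inter> B) - m A - m B)" for m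
  proof -
    have "scalar_prod N m v = (\<Sum>S\<in>Pow N. \<Sum>(A, B)\<in>Pow N \<times> Pow N. m S * d A B S)"
      unfolding scalar_prod_def v_def
      by (intro sum.cong) (auto simp: sum_distrib_left case_prod_unfold)
    also have "\<dots> = (\<Sum>(A, B)\<in>Pow N \<times> Pow N. \<Sum>S\<in>Pow N. m S * d A B S)"
      by (subst sum.swap) (simp add: case_prod_unfold)
    also have "\<dots> = (\<Sum>(A, B)\<in>Pow N \<times> Pow N. m (A \<union> B) + m (A \<inter> B) - m A - m B)"
      by (intro sum.cong) (auto simp: dm)
    finally show ?thesis .
  qed
  have nn: "\<forall>p\<in>Pow N \<times> Pow N. 0 \<le> (case p of (A, B) \<Rightarrow> m (A \<union> B) + m (A \<inter> B) - m A - m B)"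
    if "m \<in> supermodular_cone N" for m
    using that unfolding supermodular_cone_def supermodular_def by (auto simp: algebra_simps)
  have ge: "0 \<le> scalar_prod N m v" if "m \<in> supermodular_cone N" for m
    unfolding sp using nn[OF that] by (intro sum_nonneg) blast
  have "m \<in> modular_functions N \<longleftrightarrow> 0 = scalar_prod N m v" if "m \<in> supermodular_cone N" for m
  proof -
    have "scalar_prod N m v = 0 \<longleftrightarrow>
        (\<forall>p\<in>Pow N \<times> Pow N. (case p of (A, B) \<Rightarrow> m (A \<union> B) + m (A \<inter> B) - m A - m B) = 0)"
      unfolding sp using nn[OF that] fin by (intro sum_nonneg_eq_0_iff) auto
    also have "\<dots> \<longleftrightarrow> m \<in> modular_functions N"
      using that unfolding modular_functions_eq supermodular_cone_def by (auto simp: algebra_simps)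
    finally show ?thesis by auto
  qed
  then have "modular_functions N = {m \<in> supermodular_cone N. 0 = scalar_prod N m v}"
    unfolding modular_functions_def by blast
  moreover have "v \<in> set_functions N" unfolding v_def set_functions_def by auto
  ultimately show ?thesis unfolding is_face_def using ge by blast
qed

lemma modular_functions_least:
  assumes "finite N"
  shows "is_least_in (nonempty_faces N (supermodular_cone N)) (modular_functions N)"
proof -
  let ?K = "supermodular_cone N"
  define sc where "sc t m = (\<lambda>S\<in>Pow N. t * m S)" for t :: real and m :: "'a set \<Rightarrow> real"
  have sub: "A \<inter> B \<subseteq> N" if "A \<subseteq> N" for A B :: "'a set" using that by blast
  have sc_K: "sc t m \<in> ?K" if "m \<in> ?K" "0 \<le> t" for t m
  proof -
    have "t * (m A + m B) \<le> t * (m (A \<union> B) + m (A \<inter> B))" if "A \<subseteq> N" "B \<subseteq> N" for A B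
      using \<open>m \<in> ?K\<close> \<open>0 \<le> t\<close> that
      by (intro mult_left_mono) (auto simp: supermodular_cone_def supermodular_def)
    then show ?thesis
      unfolding supermodular_cone_def supermodular_def sc_def set_functions_def
      by (auto simp: sub algebra_simps)
  qed
  have sc_sp: "scalar_prod N (sc t m) v = t * scalar_prod N m v" for t m v
    unfolding scalar_prod_def sc_def sum_distrib_left by (intro sum.cong) auto
  have zero: "(\<lambda>S\<in>Pow N. 0) \<in> modular_functions N"
    unfolding modular_functions_eq set_functions_def by (auto simp: sub)
  have "modular_functions N \<subseteq> G" if G: "G \<in> nonempty_faces N ?K" for G
  proof
    fix m assume m: "m \<in> modular_functions N"
    from G obtain v k m0 where v: "\<And>m. m \<in> ?K \<Longrightarrow> k \<le> scalar_prod N m v"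
      and Gv: "G = {m \<in> ?K. k = scalar_prod N m v}" and m0: "m0 \<in> ?K" "k = scalar_prod N m0 v"
      unfolding nonempty_faces_def is_face_def by blast
    have "k \<le> 0" using v[OF sc_K[OF m0(1), of 0]] by (simp add: sc_sp)
    moreover have "k \<le> 2 * k" using v[OF sc_K[OF m0(1), of 2]] m0(2) by (simp add: sc_sp)
    ultimately have k: "k = 0" by simp
    have mK: "m \<in> ?K" "sc (-1) m \<in> ?K"
      using m unfolding modular_functions_def sc_def by auto
    have "scalar_prod N m v = 0"
      using v[OF mK(1)] v[OF mK(2)] k by (simp add: sc_sp)
    with mK(1) k Gv show "m \<in> G" by simp
  qed
  then show ?thesis
    unfolding is_least_in_def using modular_functions_face[OF assms] zero
    by (auto simp: nonempty_faces_def)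
qed

end

theory Submission
  imports Defs
begin

text \<open>
  The map \<open>T\<^sub>\<pi>\<close> is a bijection of the function space whose inverse is the transformation by
  \<open>\<pi>\<inverse>\<close>, it preserves the scalar product, and it maps the supermodular cone into itself;
  applying the last fact to \<open>\<pi>\<inverse>\<close> gives equality. Hence taking images under \<open>T\<^sub>\<pi>\<close> is an
  inclusion-preserving permutation of the set of faces, and everything defined from the face
  lattice is invariant.
\<close>

section \<open>Least elements and atoms under injective images\<close>

lemma inj_on_image_subset_iff:
  assumes "inj_on f K" "A \<subseteq> K" "B \<subseteq> K"
  shows "f ` A \<subseteq> f ` B \<longleftrightarrow> A \<subseteq> B"
  using assms unfolding inj_on_def by blast

text \<open>On subsets of \<open>K\<close>, taking images under \<open>f\<close> is an order
  embedding, so \<open>L\<close> and its image family are isomorphic ordered sets. As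
  \<open>F\<close> need not lie in \<open>L\<close>, the assumption \<open>F \<subseteq> K\<close>
  is what lets membership be pulled back.\<close>

lemma is_least_in_image_iff:
  assumes "inj_on f K" "L \<subseteq> Pow K" "F \<subseteq> K"
  shows "is_least_in ((`) f ` L) (f ` F) \<longleftrightarrow> is_least_in L F"
proof -
  have "f ` F \<in> (`) f ` L \<longleftrightarrow> F \<in> L"
    using assms by (auto simp: inj_on_image_eq_iff)
  moreover have "f ` F \<subseteq> f ` G \<longleftrightarrow> F \<subseteq> G" if "G \<in> L" for G
    using assms that by (intro inj_on_image_subset_iff) auto
  ultimately show ?thesis
    unfolding is_least_in_def by auto
qed

lemma is_atom_in_image_iff:
  assumes "inj_on f K" "L \<subseteq> Pow K" "F \<subseteq> K"
  shows "is_atom_in ((`) f ` L) (f ` F) \<longleftrightarrow> is_atom_in L F"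
proof -
  have mem: "f ` F \<in> (`) f ` L \<longleftrightarrow> F \<in> L"
    using assms by (auto simp: inj_on_image_eq_iff)
  have "f ` G \<subset> f ` F \<longleftrightarrow> G \<subset> F" if "G \<in> L" for G
  proof -
    have "G \<subseteq> K" using assms(2) that by auto
    then show ?thesis
      using assms(1,3) by (simp add: psubset_eq inj_on_image_subset_iff inj_on_image_eq_iff)
  qed
  moreover have "is_least_in ((`) f ` L) (f ` G) \<longleftrightarrow> is_least_in L G" if "G \<in> L" for G
    using assms(1,2) that by (intro is_least_in_image_iff) auto
  ultimately show ?thesis
    unfolding is_atom_in_def mem using is_least_in_image_iff[OF assms] by auto
qed

section \<open>Basic facts on faces, the transform and extensional functions\<close>

lemma is_face_subset: "is_face N K F \<Longrightarrow> F \<subseteq> K"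
  unfolding is_face_def by auto

lemma perm_transform_apply [simp]: "S \<subseteq> N \<Longrightarrow> perm_transform N \<pi> m S = m (\<pi> ` S)"
  by (simp add: perm_transform_def)

lemma perm_transform_in_set_functions: "perm_transform N \<pi> m \<in> set_functions N"
  by (simp add: perm_transform_def set_functions_def)

lemma set_functions_eqI:
  assumes "f \<in> set_functions N" "g \<in> set_functions N" "\<And>S. S \<subseteq> N \<Longrightarrow> f S = g S"
  shows "f = g"
  using assms unfolding set_functions_def by (metis PiE_ext PowD)

lemma supermodular_cone_subset: "supermodular_cone N \<subseteq> set_functions N"
  unfolding supermodular_cone_def by auto

section \<open>What a single permutation does to functions, sums and independence\<close>

context
  fixes N :: "'a set" and \<pi> :: "'a \<Rightarrow> 'a"
  assumes bij: "bij_betw \<pi> N N"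
begin

lemma image_perm_subset: "S \<subseteq> N \<Longrightarrow> \<pi> ` S \<subseteq> N"
  using bij unfolding bij_betw_def by blast

text \<open>At \<open>S\<close> the left side is the value of \<open>m\<close> at
  \<open>\<pi>\<close> inv_into N \<pi> \<open>S\<close>, which is \<open>S\<close> by surjectivity.
  Extensionality of \<open>m\<close> settles the arguments outside \<open>Pow N\<close>, where the
  transform is \<open>undefined\<close>.\<close>

lemma perm_transform_inv_left:
  assumes "m \<in> set_functions N"
  shows "perm_transform N (inv_into N \<pi>) (perm_transform N \<pi> m) = m"
proof (rule set_functions_eqI[OF perm_transform_in_set_functions assms])
  fix S assume S: "S \<subseteq> N"
  have "\<pi> ` inv_into N \<pi> ` S = S"
    using bij S by (metis bij_betw_def image_inv_into_cancel)
  moreover have "inv_into N \<pi> ` S \<subseteq> N"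
    using bij_betw_inv_into[OF bij] S unfolding bij_betw_def by blast
  ultimately show "perm_transform N (inv_into N \<pi>) (perm_transform N \<pi> m) S = m S"
    using S by simp
qed

lemma perm_transform_inv_right:
  assumes "m \<in> set_functions N"
  shows "perm_transform N \<pi> (perm_transform N (inv_into N \<pi>) m) = m"
proof (rule set_functions_eqI[OF perm_transform_in_set_functions assms])
  fix S assume S: "S \<subseteq> N"
  then show "perm_transform N \<pi> (perm_transform N (inv_into N \<pi>) m) S = m S"
    using bij image_perm_subset[OF S]
    by (simp add: inv_into_image_cancel bij_betw_def)
qed

lemma inj_on_perm_transform: "inj_on (perm_transform N \<pi>) (set_functions N)"
  by (rule inj_on_inverseI) (rule perm_transform_inv_left)

text \<open>Images commute with unions, and with intersections of subsets of \<open>N\<close> by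
  injectivity, so the inequality at \<open>A\<close>, \<open>B\<close> is that of \<open>m\<close>
  at \<open>\<pi>\<close> A\<open>,\<close>\<pi> \<open>B\<close>.\<close>

lemma perm_transform_in_supermodular_cone:
  assumes "m \<in> supermodular_cone N"
  shows "perm_transform N \<pi> m \<in> supermodular_cone N"
proof -
  have "m (\<pi> ` A) + m (\<pi> ` B) \<le> m (\<pi> ` (A \<union> B)) + m (\<pi> ` (A \<inter> B))"
    if "A \<subseteq> N" "B \<subseteq> N" for A B
  proof -
    have "\<pi> ` (A \<inter> B) = \<pi> ` A \<inter> \<pi> ` B"
      using bij that by (metis bij_betw_def inj_on_image_Int)
    then show ?thesis
      using assms image_perm_subset that
      by (simp add: supermodular_cone_def supermodular_def image_Un)
  qed
  then show ?thesis
    unfolding supermodular_cone_def supermodular_def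
    \<comment> \<open>\<open>le_infI1\<close> yields \<open>A \<inter> B \<subseteq> N\<close>, so
      that the transform can be evaluated there.\<close>
    by (simp add: perm_transform_in_set_functions le_infI1)
qed

text \<open>Taking images under \<open>\<pi>\<close> permutes \<open>Pow N\<close>, so the two sums
  differ only in the order of their terms.\<close>

lemma scalar_prod_perm_transform:
  "scalar_prod N (perm_transform N \<pi> m) (perm_transform N \<pi> v) = scalar_prod N m v"
proof -
  have "scalar_prod N (perm_transform N \<pi> m) (perm_transform N \<pi> v) =
      (\<Sum>A\<in>Pow N. m (\<pi> ` A) * v (\<pi> ` A))"
    unfolding scalar_prod_def by (intro sum.cong) auto
  also have "\<dots> = scalar_prod N m v"
    unfolding scalar_prod_def
    by (rule sum.reindex_bij_betw[OF bij_betw_Pow[OF bij]])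
  finally show ?thesis .
qed

lemma indep_perm_transform_iff:
  assumes "(a, b, C) \<in> triplets N"
  shows "indep (perm_transform N \<pi> m) a b C \<longleftrightarrow> indep m (\<pi> a) (\<pi> b) (\<pi> ` C)"
proof -
  have "a \<in> N" "b \<in> N" "C \<subseteq> N"
    using assms by (auto simp: triplets_def)
  then show ?thesis
    by (simp add: indep_def)
qed

end

section \<open>Invariance of the cone, its faces and its extreme functions\<close>

lemma perm_transform_in_supermodular_cone_iff:
  assumes "bij_betw \<pi> N N" "m \<in> set_functions N"
  shows "perm_transform N \<pi> m \<in> supermodular_cone N \<longleftrightarrow> m \<in> supermodular_cone N"
  using perm_transform_in_supermodular_cone[OF assms(1)]
    perm_transform_in_supermodular_cone[OF bij_betw_inv_into[OF assms(1)]]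
    perm_transform_inv_left[OF assms]
  by metis

lemma perm_transform_image_supermodular_cone:
  assumes "bij_betw \<pi> N N"
  shows "perm_transform N \<pi> ` supermodular_cone N = supermodular_cone N"
proof
  show "perm_transform N \<pi> ` supermodular_cone N \<subseteq> supermodular_cone N"
    using perm_transform_in_supermodular_cone[OF assms] by auto
  show "supermodular_cone N \<subseteq> perm_transform N \<pi> ` supermodular_cone N"
  proof
    fix m assume m: "m \<in> supermodular_cone N"
    then have "m = perm_transform N \<pi> (perm_transform N (inv_into N \<pi>) m)"
      using perm_transform_inv_right[OF assms] supermodular_cone_subset by (metis subsetD)
    then show "m \<in> perm_transform N \<pi> ` supermodular_cone N"
      using perm_transform_in_supermodular_cone[OF bij_betw_inv_into[OF assms] m] by blast
  qed
qed

text \<open>If \<open>v\<close> and \<open>k\<close> expose \<open>F\<close>, then the transform of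
  \<open>v\<close> with the same \<open>k\<close> exposes the image, because the cone and the scalar
  product are both invariant.\<close>

lemma is_face_perm_transform_image:
  assumes "bij_betw \<pi> N N" "is_face N (supermodular_cone N) F"
  shows "is_face N (supermodular_cone N) (perm_transform N \<pi> ` F)"
proof -
  let ?K = "supermodular_cone N" and ?T = "perm_transform N \<pi>"
  obtain v k where v: "\<forall>m\<in>?K. k \<le> scalar_prod N m v" "F = {m \<in> ?K. k = scalar_prod N m v}"
    using assms(2) unfolding is_face_def by auto
  have K: "?T ` ?K = ?K"
    by (rule perm_transform_image_supermodular_cone[OF assms(1)])
  have "\<forall>m\<in>?T ` ?K. k \<le> scalar_prod N m (?T v)"
    using v(1) by (simp add: scalar_prod_perm_transform[OF assms(1)])
  moreover have "?T ` F = {m \<in> ?T ` ?K. k = scalar_prod N m (?T v)}"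
    unfolding v(2) by (auto simp: scalar_prod_perm_transform[OF assms(1)])
  ultimately show ?thesis
    unfolding is_face_def K using perm_transform_in_set_functions by blast
qed

text \<open>Surjectivity on faces: the preimage of a face is its image under the inverse
  permutation, again a face.\<close>

lemma perm_transform_image_faces:
  assumes "bij_betw \<pi> N N"
  shows "(`) (perm_transform N \<pi>) ` {F. is_face N (supermodular_cone N) F} =
    {F. is_face N (supermodular_cone N) F}"
proof
  show "(`) (perm_transform N \<pi>) ` {F. is_face N (supermodular_cone N) F}
      \<subseteq> {F. is_face N (supermodular_cone N) F}"
    using is_face_perm_transform_image[OF assms] by auto
  show "{F. is_face N (supermodular_cone N) F}
      \<subseteq> (`) (perm_transform N \<pi>) ` {F. is_face N (supermodular_cone N) F}"
  proof
    fix F assume "F \<in> {F. is_face N (supermodular_cone N) F}"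
    then have F: "is_face N (supermodular_cone N) F" by simp
    let ?G = "perm_transform N (inv_into N \<pi>) ` F"
    have "F \<subseteq> set_functions N"
      using is_face_subset[OF F] supermodular_cone_subset by blast
    then have "perm_transform N \<pi> ` ?G = F"
      using perm_transform_inv_right[OF assms] by (force simp: image_image)
    moreover have "is_face N (supermodular_cone N) ?G"
      by (rule is_face_perm_transform_image[OF bij_betw_inv_into[OF assms] F])
    ultimately show "F \<in> (`) (perm_transform N \<pi>) ` {F. is_face N (supermodular_cone N) F}"
      by blast
  qed
qed

text \<open>Extremality refers only to two families: the faces through \<open>m\<close> and the
  non-empty faces. The first is carried onto the faces through the transformed function, the second
  onto itself, so the order lemmas apply.\<close>

lemma extreme_in_cone_perm_transform_iff:
  assumes bij: "bij_betw \<pi> N N" and m: "m \<in> supermodular_cone N"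
  shows "extreme_in_cone N (perm_transform N \<pi> m) \<longleftrightarrow> extreme_in_cone N m"
proof -
  let ?K = "supermodular_cone N" and ?T = "perm_transform N \<pi>"
  let ?A = "{F. is_face N ?K F}"
  let ?L = "\<lambda>m. {F. is_face N ?K F \<and> m \<in> F}" and ?M = "nonempty_faces N ?K"
  have inj: "inj_on ?T ?K"
    using inj_on_perm_transform[OF bij] supermodular_cone_subset by (rule inj_on_subset)
  have A: "(`) ?T ` ?A = ?A"
    by (rule perm_transform_image_faces[OF bij])
  \<comment> \<open>Injectivity is available only on the cone, hence the restriction to
    faces.\<close>
  have mem: "?T m \<in> ?T ` F \<longleftrightarrow> m \<in> F" if "F \<in> ?A" for F
    using that by (intro inj_on_image_mem_iff[OF inj m] is_face_subset) simp
  have "?L (?T m) = {F \<in> (`) ?T ` ?A. ?T m \<in> F}"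
    unfolding A by simp
  also have "\<dots> = (`) ?T ` ?L m"
    using mem by blast
  finally have L: "?L (?T m) = (`) ?T ` ?L m" .
  have "?M = {F \<in> (`) ?T ` ?A. F \<noteq> {}}"
    unfolding A nonempty_faces_def by simp
  also have "\<dots> = (`) ?T ` ?M"
    unfolding nonempty_faces_def by blast
  finally have M: "?M = (`) ?T ` ?M" .
  have sub: "?L m \<subseteq> Pow ?K" "?M \<subseteq> Pow ?K"
    using is_face_subset unfolding nonempty_faces_def by blast+
  have least: "is_least_in (?L (?T m)) (?T ` F) \<longleftrightarrow> is_least_in (?L m) F" if "F \<subseteq> ?K" for F
    unfolding L using inj sub(1) that by (rule is_least_in_image_iff)
  \<comment> \<open>The invariance \<open>M\<close> folds the image family back into
    \<open>?M\<close>, so both sides speak of the same lattice.\<close>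
  have atom: "is_atom_in ?M (?T ` F) \<longleftrightarrow> is_atom_in ?M F" if "F \<subseteq> ?K" for F
    using is_atom_in_image_iff[OF inj sub(2) that] unfolding M[symmetric] .
  have "(\<exists>F. is_least_in (?L (?T m)) F \<and> is_atom_in ?M F) \<longleftrightarrow>
      (\<exists>F\<in>?A. is_least_in (?L (?T m)) F \<and> is_atom_in ?M F)"
    by (auto simp: is_least_in_def)
  also have "\<dots> \<longleftrightarrow> (\<exists>F\<in>?A. is_least_in (?L (?T m)) (?T ` F) \<and> is_atom_in ?M (?T ` F))"
    using bex_simps(7)[of "(`) ?T" ?A] unfolding A by simp
  also have "\<dots> \<longleftrightarrow> (\<exists>F\<in>?A. is_least_in (?L m) F \<and> is_atom_in ?M F)"
    by (intro bex_cong refl) (simp add: least atom is_face_subset)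
  also have "\<dots> \<longleftrightarrow> (\<exists>F. is_least_in (?L m) F \<and> is_atom_in ?M F)"
    by (auto simp: is_least_in_def)
  finally show ?thesis
    unfolding extreme_in_cone_def
    using m perm_transform_in_supermodular_cone[OF bij m] by simp
qed

text \<open>In the inclusion statement \<open>set_functions N\<close> stands for the whole space:
  functions of the HOL type that differ only outside \<open>Pow N\<close> have equal transforms, so
  injectivity holds on extensional functions.\<close>

theorem mainTheorem1:
  fixes N :: "'a set" and \<pi> :: "'a \<Rightarrow> 'a" and m :: "'a set \<Rightarrow> real"
  assumes "finite N" and "card N \<ge> 2"
    and "bij_betw \<pi> N N"
    and "m \<in> set_functions N"
  shows
    "((m \<in> supermodular_cone N \<longleftrightarrow> perm_transform N \<pi> m \<in> supermodular_cone N) \<and>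
      (\<forall>(a, b, C)\<in>triplets N.
         indep (perm_transform N \<pi> m) a b C \<longleftrightarrow> indep m (\<pi> a) (\<pi> b) (\<pi> ` C)) \<and>
      (m \<in> supermodular_cone N \<longrightarrow>
         indep_model N (perm_transform N \<pi> m) =
           {(a, b, C) \<in> triplets N. indep m (\<pi> a) (\<pi> b) (\<pi> ` C)}) \<and>
      perm_transform N \<pi> ` supermodular_cone N = supermodular_cone N)
     \<and>
     ((\<forall>F. is_face N (supermodular_cone N) F \<longrightarrow>
           is_face N (supermodular_cone N) (perm_transform N \<pi> ` F)) \<and>
      (\<forall>G F. G \<subseteq> set_functions N \<longrightarrow> F \<subseteq> set_functions N \<longrightarrow>
         (G \<subseteq> F \<longleftrightarrow> perm_transform N \<pi> ` G \<subseteq> perm_transform N \<pi> ` F)) \<and>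
      (m \<in> supermodular_cone N \<longrightarrow>
         (extreme_in_cone N m \<longleftrightarrow> extreme_in_cone N (perm_transform N \<pi> m))))"
proof (intro conjI impI allI)
  note bij = assms(3) and m = assms(4)
  let ?K = "supermodular_cone N" and ?T = "perm_transform N \<pi>"
  show "m \<in> ?K \<longleftrightarrow> ?T m \<in> ?K"
    using perm_transform_in_supermodular_cone_iff[OF bij m] by simp
  show "\<forall>(a, b, C)\<in>triplets N. indep (?T m) a b C \<longleftrightarrow> indep m (\<pi> a) (\<pi> b) (\<pi> ` C)"
    using indep_perm_transform_iff[OF bij] by blast
  show "indep_model N (?T m) = {(a, b, C) \<in> triplets N. indep m (\<pi> a) (\<pi> b) (\<pi> ` C)}"
    unfolding indep_model_def using indep_perm_transform_iff[OF bij] by blast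
  show "?T ` ?K = ?K"
    by (rule perm_transform_image_supermodular_cone[OF bij])
  show "is_face N ?K (?T ` F)" if "is_face N ?K F" for F
    using bij that by (rule is_face_perm_transform_image)
  show "G \<subseteq> F \<longleftrightarrow> ?T ` G \<subseteq> ?T ` F" if "G \<subseteq> set_functions N" "F \<subseteq> set_functions N" for G F
    using inj_on_image_subset_iff[OF inj_on_perm_transform[OF bij] that] by simp
  show "extreme_in_cone N m \<longleftrightarrow> extreme_in_cone N (?T m)" if "m \<in> ?K"
    using extreme_in_cone_perm_transform_iff[OF bij that] by simp
qed

end
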